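(* The set of losing positions for the game $\mathrm{CN}(8,6)$ is, up to symmetry (rotation and reflection of the circle), $$\mathcal{L}=\{(0,x,a_1,b_1,e,b_2,a_2,x)\mid a_1+b_1=a_2+b_2=x \text{ and } e=\min(x,a_1+a_2)\},$$ where $x,a_1,b_1,a_2,b_2,e$ are non-negative integers. That is, a position is losing if and only if at least one of its symmetries lies in the displayed set.
   Context: For integers $1\le k\le n$, circular Nim $\mathrm{CN}(n,k)$ is the following two-player impartial game. A position is a vector $\mathbf p=(p_1,\ldots,p_n)$ of non-negative integers, the heights of $n$ stacks of tokens placed in a circle in this order (indices modulo $n$). A legal move consists of choosing $k$ cyclically consecutive stacks $i,i+1,\ldots,i+k-1$ (modulo $n$) and removing $a_j$ tokens, $0\le a_j\le p_j$, from each chosen stack $j$, with at least one token removed in total. Players alternate; a player who cannot move loses. A position is losing (belongs to $\mathcal{L}$) if the player about to move from it loses under optimal play by the opponent; equivalently, $\mathcal{L}$ is the set of positions none of whose options (positions reachable by one legal move) lies in $\mathcal{L}$. A position may be represented by $\mathbf p$ or any of its symmetries, i.e. the vectors $(p_\ell,p_{\ell+1},\ldots,p_n,p_1,\ldots,p_{\ell-1})$ and $(p_{\ell-1},p_{\ell-2},\ldots,p_1,p_n,\ldots,p_\ell)$ for $1\le \ell\le n$; sets of positions are described up to these symmetries. *)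

theory Defs
  imports Main
begin

text \<open>
  Positions of CN(n,k) are lists of length n. Stacks 1, ..., n are the list
  indices 0, ..., n - 1.
\<close>

definition positions :: "nat \<Rightarrow> nat list set" where
  "positions n = {p. length p = n}"

definition window :: "nat \<Rightarrow> nat \<Rightarrow> nat \<Rightarrow> nat set" where
  "window n k i = {(i + t) mod n | t. t < k}"

definition cn_move :: "nat \<Rightarrow> nat \<Rightarrow> nat list \<Rightarrow> nat list \<Rightarrow> bool" where
  "cn_move n k p q \<longleftrightarrow>
     p \<in> positions n \<and> q \<in> positions n \<and>
     (\<exists>i<n. (\<forall>j<n. j \<in> window n k i \<longrightarrow> q ! j \<le> p ! j) \<and>
            (\<forall>j<n. j \<notin> window n k i \<longrightarrow> q ! j = p ! j) \<and>
            (\<exists>j<n. q ! j < p ! j))"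

text \<open>
  Outcome under optimal play: the player to move loses if every move leads to a position
  won by the opponent (in particular if there is no move), and wins if some move leads to
  a position lost by the opponent.
\<close>

inductive losing :: "nat \<Rightarrow> nat \<Rightarrow> nat list \<Rightarrow> bool"
  and winning :: "nat \<Rightarrow> nat \<Rightarrow> nat list \<Rightarrow> bool" for n k where
  losingI: "p \<in> positions n \<Longrightarrow> (\<And>q. cn_move n k p q \<Longrightarrow> winning n k q) \<Longrightarrow> losing n k p"
| winningI: "cn_move n k p q \<Longrightarrow> losing n k q \<Longrightarrow> winning n k p"

definition losing_positions :: "nat \<Rightarrow> nat \<Rightarrow> nat list set" where
  "losing_positions n k = {p. losing n k p}"

definition symmetries :: "nat list \<Rightarrow> nat list set" where
  "symmetries p = {rotate l p | l. l < length p} \<union> {rev (rotate l p) | l. l < length p}"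

lemma cn_move_sum_list_less:
  assumes "cn_move n k p q"
  shows "sum_list q < sum_list p"
proof -
  have len: "length p = n" "length q = n"
    using assms by (auto simp: cn_move_def positions_def)
  have le: "\<forall>j\<in>{0..<n}. q ! j \<le> p ! j" and lt: "\<exists>j\<in>{0..<n}. q ! j < p ! j"
    using assms by (fastforce simp: cn_move_def)+
  show ?thesis
    unfolding sum_list_sum_nth len using sum_strict_mono_ex1[OF _ le lt] by simp
qed

lemma winning_iff_not_losing:
  "p \<in> positions n \<Longrightarrow> winning n k p \<longleftrightarrow> \<not> losing n k p"
proof (induction "sum_list p" arbitrary: p rule: less_induct)
  case less
  have IH: "winning n k q \<longleftrightarrow> \<not> losing n k q" if "cn_move n k p q" for q
    using less.hyps[OF cn_move_sum_list_less[OF that]] that by (simp add: cn_move_def)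
  show ?case
    using IH less.prems by (metis losing.cases losingI winning.cases winningI)
qed

text \<open>
  The characterization of the losing positions by their options; as moves decrease the
  number of tokens, it determines the set.
\<close>

lemma losing_positions_iff:
  "p \<in> losing_positions n k \<longleftrightarrow>
     p \<in> positions n \<and> (\<forall>q. cn_move n k p q \<longrightarrow> q \<notin> losing_positions n k)"
  unfolding losing_positions_def mem_Collect_eq
  by (metis losing.cases losingI winningI winning_iff_not_losing cn_move_def)

end

theory Submission
  imports Defs
begin

text \<open>
  A move of CN(8,6) leaves two adjacent stacks untouched and may lower all the others. Hence the
  claim is a statement of linear arithmetic about eight numbers: two members of the family, one
  below the other and agreeing on two adjacent stacks, are equal, and below every position there
  is a member of the family agreeing with it on two adjacent stacks. For the second part choose
  the orientation such that stacks 0 and 1 form an adjacent pair of minimal sum m, stack 0 being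
  the lower one. Comparing a few stacks with each other and with m then shows which pair to keep.
\<close>

section \<open>Symmetries of the circle\<close>

lemma symmetries_self: "p \<noteq> [] \<Longrightarrow> p \<in> symmetries p"
  unfolding symmetries_def by (auto intro!: exI[of _ 0])

lemma rotate_in_symmetries: "p \<noteq> [] \<Longrightarrow> rotate m p \<in> symmetries p"
  unfolding symmetries_def by (auto intro!: exI[of _ "m mod length p"] simp: rotate_conv_mod[symmetric])

lemma rev_rotate_in_symmetries: "p \<noteq> [] \<Longrightarrow> rev (rotate m p) \<in> symmetries p"
  unfolding symmetries_def by (auto intro!: exI[of _ "m mod length p"] simp: rotate_conv_mod[symmetric])

lemma symmetries_cases:
  assumes "q \<in> symmetries p"
  obtains m where "q = rotate m p" | m where "q = rev (rotate m p)"
  using assms unfolding symmetries_def by blast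

lemma length_symmetries: "q \<in> symmetries p \<Longrightarrow> length q = length p"
  by (auto elim: symmetries_cases)

text \<open>A reversal can be moved past a rotation at the price of changing the rotation
  (\<open>rotate_rev\<close>), so two symmetries compose to a rotation followed by at most one
  reversal.\<close>

lemma symmetries_trans:
  assumes "q \<in> symmetries p" "r \<in> symmetries q"
  shows "r \<in> symmetries p"
proof -
  have ne: "p \<noteq> []" using assms(1) by (auto simp: symmetries_def)
  show ?thesis
    using assms(2) assms(1)
    by (auto elim!: symmetries_cases
        simp: rotate_rotate rotate_rev rotate_in_symmetries[OF ne] rev_rotate_in_symmetries[OF ne])
qed

lemma rotate_inverse: "rotate (length p - m mod length p) (rotate m p) = p"
proof (cases "p = []")
  case False
  have "rotate (length p - m mod length p) (rotate m p)
      = rotate (length p - m mod length p) (rotate (m mod length p) p)"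
    by (simp add: rotate_conv_mod[symmetric])
  also have "\<dots> = rotate (length p - m mod length p + m mod length p) p"
    by (simp only: rotate_rotate)
  also have "\<dots> = p"
    using False by simp
  finally show ?thesis .
qed simp

lemma symmetries_sym:
  assumes "q \<in> symmetries p"
  shows "p \<in> symmetries q"
proof -
  have ne: "p \<noteq> []" "q \<noteq> []"
    using assms length_symmetries[OF assms] by (auto simp: symmetries_def)
  from assms show ?thesis
  proof (cases rule: symmetries_cases)
    case (1 m)
    then show ?thesis using rotate_inverse[of p m] rotate_in_symmetries[OF ne(2)] by metis
  next
    case (2 m)
    then have "rev q = rotate m p" by simp
    then have "p = rotate (length p - m mod length p) (rev q)" by (simp add: rotate_inverse)
    then show ?thesis using rev_rotate_in_symmetries[OF ne(2)] by (metis rotate_rev)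
  qed
qed

section \<open>Moves of CN(8,6)\<close>

text \<open>Six consecutive stacks out of eight are the complement of two adjacent ones.\<close>

definition keeps :: "nat list \<Rightarrow> nat list \<Rightarrow> bool" where
  "keeps p q \<longleftrightarrow> length p = 8 \<and> length q = 8 \<and> (\<forall>j<8. q ! j \<le> p ! j) \<and>
     (\<exists>i<8. q ! i = p ! i \<and> q ! ((i + 1) mod 8) = p ! ((i + 1) mod 8))"

lemma less_8: "(i::nat) < 8 \<longleftrightarrow> i = 0 \<or> i = 1 \<or> i = 2 \<or> i = 3 \<or> i = 4 \<or> i = 5 \<or> i = 6 \<or> i = 7"
  by linarith
lemma all_less_8: "(\<forall>i<8::nat. P i) \<longleftrightarrow> P 0 \<and> P 1 \<and> P 2 \<and> P 3 \<and> P 4 \<and> P 5 \<and> P 6 \<and> P 7"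
  unfolding less_8 by blast

lemma ex_less_8: "(\<exists>i<8::nat. P i) \<longleftrightarrow> P 0 \<or> P 1 \<or> P 2 \<or> P 3 \<or> P 4 \<or> P 5 \<or> P 6 \<or> P 7"
  unfolding less_8 by blast

lemma length_8E:
  assumes "length p = 8"
  obtains a b c d e f g h where "p = [a, b, c, d, e, f, g, h]"
proof -
  have "length p = Suc (Suc (Suc (Suc (Suc (Suc (Suc (Suc 0)))))))" using assms by simp
  then show ?thesis using that by (simp add: length_Suc_conv) blast
qed

lemma keeps_8:
  "keeps [a, b, c, d, e, f, g, h] [a', b', c', d', e', f', g', h'] \<longleftrightarrow>
     (a' \<le> a \<and> b' \<le> b \<and> c' \<le> c \<and> d' \<le> d \<and> e' \<le> e \<and> f' \<le> f \<and> g' \<le> g \<and> h' \<le> h) \<and>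
     (a' = a \<and> b' = b \<or> b' = b \<and> c' = c \<or> c' = c \<and> d' = d \<or> d' = d \<and> e' = e \<or>
      e' = e \<and> f' = f \<or> f' = f \<and> g' = g \<or> g' = g \<and> h' = h \<or> h' = h \<and> a' = a)"
  unfolding keeps_def all_less_8 ex_less_8 by simp

lemma window_8_6:
  assumes "i < 8" "j < 8"
  shows "j \<notin> window 8 6 i \<longleftrightarrow> j = (i + 6) mod 8 \<or> j = (i + 7) mod 8"
proof -
  have "window 8 6 i = (\<lambda>t. (i + t) mod 8) ` {..<6}" unfolding window_def by auto
  also have "{..<6::nat} = {0, 1, 2, 3, 4, 5}" by auto
  finally have w: "window 8 6 i = (\<lambda>t. (i + t) mod 8) ` {0, 1, 2, 3, 4, 5}" .
  have "\<forall>i<8. \<forall>j<8. j \<notin> (\<lambda>t. (i + t) mod 8) ` {0, 1, 2, 3, 4, 5} \<longleftrightarrow>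
      j = (i + 6) mod 8 \<or> j = (i + 7) mod (8::nat)"
    unfolding all_less_8 by simp
  then show ?thesis using assms w by simp
qed

lemma cn_move_8_6: "cn_move 8 6 p q \<longleftrightarrow> keeps p q \<and> q \<noteq> p"
proof (cases "length p = 8 \<and> length q = 8")
  case True
  have *: "(\<forall>j<8. j \<in> window 8 6 i \<longrightarrow> q ! j \<le> p ! j) \<and>
      (\<forall>j<8. j \<notin> window 8 6 i \<longrightarrow> q ! j = p ! j) \<longleftrightarrow>
      (\<forall>j<8. q ! j \<le> p ! j) \<and>
      q ! ((i + 6) mod 8) = p ! ((i + 6) mod 8) \<and> q ! ((i + 7) mod 8) = p ! ((i + 7) mod 8)"
    if "i < 8" for i
  proof -
    define x y where "x = (i + 6) mod 8" and "y = (i + 7) mod 8"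
    have xy: "x < 8" "y < 8" by (simp_all add: x_def y_def)
    have w: "j \<in> window 8 6 i \<longleftrightarrow> j \<noteq> x \<and> j \<noteq> y" if "j < 8" for j
      using window_8_6[OF \<open>i < 8\<close> that] unfolding x_def y_def by blast
    have "(\<forall>j<8. j \<notin> window 8 6 i \<longrightarrow> q ! j = p ! j) \<longleftrightarrow> q ! x = p ! x \<and> q ! y = p ! y"
      using xy by (auto simp: w)
    \<comment> \<open>At the two untouched stacks equality gives the bound, so the bound may be
      demanded on the whole circle.\<close>
    moreover have "(\<forall>j<8. j \<in> window 8 6 i \<longrightarrow> q ! j \<le> p ! j) \<longleftrightarrow> (\<forall>j<8. q ! j \<le> p ! j)"
      if "q ! x = p ! x" "q ! y = p ! y"
      using that by (metis w order_refl)
    ultimately show ?thesis unfolding x_def[symmetric] y_def[symmetric] by argo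
  qed
  have pull: "(\<exists>i<8. A i \<and> B i \<and> C) \<longleftrightarrow> (\<exists>i<8. A i \<and> B i) \<and> C" for A B :: "nat \<Rightarrow> bool" and C
    by blast
  have "cn_move 8 6 p q \<longleftrightarrow> (\<exists>i<8. (\<forall>j<8. q ! j \<le> p ! j) \<and>
      q ! ((i + 6) mod 8) = p ! ((i + 6) mod 8) \<and> q ! ((i + 7) mod 8) = p ! ((i + 7) mod 8)) \<and>
      (\<exists>j<8. q ! j < p ! j)"
    by (simp only: cn_move_def positions_def mem_Collect_eq True simp_thms pull * cong: conj_cong)
  also have "\<dots> \<longleftrightarrow> keeps p q \<and> (\<exists>j<8. q ! j < p ! j)"
  proof -
    \<comment> \<open>\<open>i + 6\<close> runs through all residues modulo 8 together with
      \<open>i\<close>, so the untouched pair can be renamed.\<close>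
    have "(\<exists>i<8. R ((i + 6) mod 8) ((i + 7) mod 8)) \<longleftrightarrow> (\<exists>i<8. R i ((i + 1) mod 8))"
      for R :: "nat \<Rightarrow> nat \<Rightarrow> bool"
      unfolding ex_less_8 by (simp del: One_nat_def) blast
    note reindex = this[of "\<lambda>k l. q ! k = p ! k \<and> q ! l = p ! l"]
    have pull: "(\<exists>i<8. A \<and> C i) \<longleftrightarrow> A \<and> (\<exists>i<8. C i)" for A and C :: "nat \<Rightarrow> bool"
      by blast
    show ?thesis
      by (simp only: pull reindex keeps_def True simp_thms)
  qed
  also have "\<dots> \<longleftrightarrow> keeps p q \<and> q \<noteq> p"
  proof -
    have "(\<exists>j<8. q ! j < p ! j) \<longleftrightarrow> q \<noteq> p" if "\<forall>j<8. q ! j \<le> p ! j"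
      using that True by (auto simp: list_eq_iff_nth_eq less_le)
    then show ?thesis unfolding keeps_def by meson
  qed
  finally show ?thesis .
qed (auto simp: cn_move_def positions_def keeps_def)

lemma keeps_rotate: "keeps p q \<Longrightarrow> keeps (rotate m p) (rotate m q)"
proof (induction m)
  case (Suc m)
  let ?p = "rotate m p" and ?q = "rotate m q"
  have "length ?p = 8" "length ?q = 8" using Suc by (auto simp: keeps_def)
  then have "keeps (rotate1 ?p) (rotate1 ?q)"
    using Suc by (elim length_8E) (auto simp: keeps_8)
  then show ?case by simp
qed simp

lemma keeps_rev:
  assumes "keeps p q"
  shows "keeps (rev p) (rev q)"
proof -
  have "length p = 8" "length q = 8" using assms by (auto simp: keeps_def)
  then show ?thesis using assms by (elim length_8E) (auto simp: keeps_8)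
qed

section \<open>The family of losing positions\<close>

definition family :: "nat list set" where
  "family = {[0, x, a1, b1, e, b2, a2, x] | x a1 b1 e b2 a2.
     a1 + b1 = x \<and> a2 + b2 = x \<and> e = min x (a1 + a2)}"

definition sym_family :: "nat list set" where
  "sym_family = {p. \<exists>q \<in> symmetries p. q \<in> family}"

text \<open>The minimum becomes two upper bounds of which one is attained, and \<open>x\<close> is
  eliminated; only linear conditions remain.\<close>

lemma family_8:
  "[a, b, c, d, e, f, g, h] \<in> family \<longleftrightarrow> a = 0 \<and> b = h \<and> c + d = h \<and> g + f = h \<and>
     e \<le> h \<and> e \<le> c + g \<and> (e = h \<or> e = c + g)"
  unfolding family_def by (auto simp: min_def)

lemma length_family: "p \<in> family \<Longrightarrow> length p = 8"
  unfolding family_def by auto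

lemma length_sym_family: "p \<in> sym_family \<Longrightarrow> length p = 8"
  unfolding sym_family_def using length_family length_symmetries by fastforce

lemma family_subset: "family \<subseteq> sym_family"
proof
  fix p assume p: "p \<in> family"
  then have "p \<noteq> []" using length_family by force
  then show "p \<in> sym_family" using p symmetries_self unfolding sym_family_def by blast
qed

lemma sym_family_symmetries: "p \<in> sym_family \<Longrightarrow> q \<in> symmetries p \<Longrightarrow> q \<in> sym_family"
  unfolding sym_family_def using symmetries_sym symmetries_trans by blast

text \<open>The family is invariant under the reflection fixing stacks 0 and 4, so rotations suffice.\<close>

lemma sym_family_8:
  assumes "[a, b, c, d, e, f, g, h] \<in> sym_family"
  shows "[a, b, c, d, e, f, g, h] \<in> family \<or> [b, c, d, e, f, g, h, a] \<in> family \<or>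
    [c, d, e, f, g, h, a, b] \<in> family \<or> [d, e, f, g, h, a, b, c] \<in> family \<or>
    [e, f, g, h, a, b, c, d] \<in> family \<or> [f, g, h, a, b, c, d, e] \<in> family \<or>
    [g, h, a, b, c, d, e, f] \<in> family \<or> [h, a, b, c, d, e, f, g] \<in> family"
proof -
  have reflect: "[a, h, g, f, e, d, c, b] \<in> family \<longleftrightarrow> [a, b, c, d, e, f, g, h] \<in> family"
    for a b c d e f g h by (auto simp: family_8 add.commute)
  have "symmetries p = {rotate l p | l. l < 8} \<union> {rev (rotate l p) | l. l < 8}" if "length p = 8" for p
    using that unfolding symmetries_def by simp
  from this[of "[a, b, c, d, e, f, g, h]"]
  have "\<exists>l<8. rotate l [a, b, c, d, e, f, g, h] \<in> family \<or>
      rev (rotate l [a, b, c, d, e, f, g, h]) \<in> family"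
    using assms unfolding sym_family_def by simp blast
  then show ?thesis
    unfolding ex_less_8 by (simp add: rotate_drop_take) (metis reflect)
qed

text \<open>Comparing totals suffices: \<open>q\<close> lies below \<open>p\<close> stack by stack,
  so a total not smaller than that of \<open>p\<close> forces equality.\<close>

lemma family_no_move:
  assumes "p \<in> family" "q \<in> sym_family" "keeps p q"
  shows "q = p"
proof -
  obtain x a1 b1 m b2 a2 where p: "p = [0, x, a1, b1, m, b2, a2, x]"
    using assms(1) unfolding family_def by blast
  obtain a b c d e f g h where q: "q = [a, b, c, d, e, f, g, h]"
    using length_8E[OF length_sym_family[OF assms(2)]] .
  note P = assms(1)[unfolded p family_8] and K = assms(3)[unfolded p q keeps_8]
  \<comment> \<open>One linear problem for each orientation of \<open>q\<close>, each kept pair and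
    each choice of the attained bounds in the two minima.\<close>
  have "x + a1 + b1 + m + b2 + a2 + x \<le> a + b + c + d + e + f + g + h"
    using sym_family_8[OF assms(2)[unfolded q]] P K unfolding family_8
    by (elim disjE conjE; linarith)
  then show ?thesis
    using K[THEN conjunct1] unfolding p q list.inject by (intro conjI refl; linarith)
qed

section \<open>Moving into the family\<close>

text \<open>Since \<open>keeps\<close> admits \<open>q = p\<close>, members of the family reach
  themselves, and the property can be shown for all positions alike.\<close>

definition reaches :: "nat list \<Rightarrow> bool" where
  "reaches p \<longleftrightarrow> (\<exists>q \<in> sym_family. keeps p q)"

lemma reaches_symmetries:
  assumes "reaches p" "r \<in> symmetries p"
  shows "reaches r"
proof -
  obtain q where q: "q \<in> sym_family" "keeps p q" using assms(1) unfolding reaches_def by blast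
  then have ne: "q \<noteq> []" unfolding keeps_def by auto
  from assms(2) show ?thesis
  proof (cases rule: symmetries_cases)
    case (1 m)
    then show ?thesis
      using keeps_rotate[OF q(2)] sym_family_symmetries[OF q(1) rotate_in_symmetries[OF ne]]
      unfolding reaches_def by blast
  next
    case (2 m)
    then show ?thesis
      using keeps_rev[OF keeps_rotate[OF q(2)]]
        sym_family_symmetries[OF q(1) rev_rotate_in_symmetries[OF ne]]
      unfolding reaches_def by blast
  qed
qed

lemma reaches_rotate: "p \<noteq> [] \<Longrightarrow> reaches (rotate m p) \<Longrightarrow> reaches p"
  using reaches_symmetries symmetries_sym rotate_in_symmetries by blast

lemma reaches_rev_rotate: "p \<noteq> [] \<Longrightarrow> reaches (rev (rotate m p)) \<Longrightarrow> reaches p"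
  using reaches_symmetries symmetries_sym rev_rotate_in_symmetries by blast

lemma reachesI: "q \<in> family \<Longrightarrow> keeps p q \<Longrightarrow> reaches p"
  unfolding reaches_def using family_subset by blast

text \<open>
  Sufficient conditions for a move to a member of the family written in the standard
  orientation; the name tells which two adjacent stacks stay untouched.
\<close>

lemma reaches_12:
  assumes "b \<le> h" "c \<le> b" "b \<le> c + d" "b \<le> f + g" "b \<le> e \<or> c \<le> e \<and> b + c \<le> e + f"
  shows "reaches [a, b, c, d, e, f, g, h]"
  using assms
  \<comment> \<open>The kept stacks fix \<open>x = b\<close> and \<open>a1 = c\<close>. By truncated
    subtraction \<open>b2 = b - (b - f)\<close> is \<open>min b f\<close>, the largest choice; it
    makes \<open>a2\<close>, and with it the stack opposite the empty one, as small as
    possible.\<close>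
  by (intro reachesI[of "[0, b, c, b - c, min b (c + (b - f)), b - (b - f), b - f, b]"])
    (auto simp: family_8 keeps_8 min_def)

lemma reaches_23:
  assumes "c + d \<le> b" "c + d \<le> h" "c + d \<le> f + g" "c + d \<le> e \<or> c \<le> e \<and> c + c + d \<le> e + f"
  shows "reaches [a, b, c, d, e, f, g, h]"
  using assms
  \<comment> \<open>Now \<open>x = c + d\<close>; again \<open>b2 = min x f\<close> is the largest
    choice.\<close>
  by (intro reachesI[of "[0, c + d, c, d, min (c + d) (c + (c + d - f)),
        c + d - (c + d - f), c + d - f, c + d]"])
    (auto simp: family_8 keeps_8 min_def)

lemma reaches_34:
  assumes "e \<le> b" "e \<le> h" "d \<le> e" "e \<le> c + d" "e \<le> f + g" "d \<le> g"
  shows "reaches [a, b, c, d, e, f, g, h]"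
  using assms
  \<comment> \<open>Here the minimum is \<open>x = e\<close>, and \<open>a2 = min e g\<close> is as
    large as possible to ensure \<open>x \<le> a1 + a2\<close>.\<close>
  by (intro reachesI[of "[0, e, e - d, d, e, e - min e g, min e g, e]"])
    (auto simp: family_8 keeps_8 min_def)

lemma reaches_34':
  assumes "g \<le> d" "g \<le> e" "e \<le> c + g" "d + e \<le> f + 2 * g" "d + e \<le> b + g" "d + e \<le> g + h"
  shows "reaches [a, b, c, d, e, f, g, h]"
  using assms
  \<comment> \<open>Here the minimum is \<open>a1 + a2 = e\<close> with \<open>a2 = g\<close> left
    whole, hence \<open>a1 = e - g\<close> and \<open>x = d + e - g\<close>.\<close>
  by (intro reachesI[of "[0, d + e - g, e - g, d, e, d + e - g - g, g, d + e - g]"])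
    (auto simp: family_8 keeps_8 min_def)

text \<open>\<open>a \<le> c\<close> and \<open>b \<le> h\<close> are
  \<open>a + b \<le> b + c\<close> and \<open>a + b \<le> h + a\<close> after cancellation, so the
  assumptions express that the pair \<open>a\<close>, \<open>b\<close> has least sum.\<close>

lemma reaches_if_min_pair:
  assumes "a \<le> b" "a \<le> c" "b \<le> h" "a + b \<le> c + d" "a + b \<le> d + e"
    "a + b \<le> e + f" "a + b \<le> f + g" "a + b \<le> g + h"
  shows "reaches [a, b, c, d, e, f, g, h]" (is "reaches ?p")
proof -
  have rot3: "reaches [d, e, f, g, h, a, b, c] \<Longrightarrow> reaches ?p"
    using reaches_rotate[of ?p 3] by (simp add: rotate_drop_take)
  have rot6: "reaches [g, h, a, b, c, d, e, f] \<Longrightarrow> reaches ?p"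
    using reaches_rotate[of ?p 6] by (simp add: rotate_drop_take)
  have rev1: "reaches [a, h, g, f, e, d, c, b] \<Longrightarrow> reaches ?p"
    using reaches_rev_rotate[of ?p 1] by (simp add: rotate_drop_take)
  have rev4: "reaches [d, c, b, a, h, g, f, e] \<Longrightarrow> reaches ?p"
    using reaches_rev_rotate[of ?p 4] by (simp add: rotate_drop_take)
  have rev7: "reaches [g, f, e, d, c, b, a, h] \<Longrightarrow> reaches ?p"
    using reaches_rev_rotate[of ?p 7] by (simp add: rotate_drop_take)
  \<comment> \<open>The kept pair is \<open>b\<close>, \<open>c\<close> in A, C, J, M;
    \<open>e\<close>, \<open>f\<close> in B, E, H, K; \<open>h\<close>, \<open>a\<close> in D, I, L;
    \<open>a\<close>, \<open>b\<close> in F, G. The emptied stack is \<open>a\<close> in A, H, K;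
    \<open>d\<close> in B, C, F, I, L; \<open>g\<close> in the others.\<close>
  have A: "reaches ?p" if "c \<le> b" "b \<le> e \<or> c \<le> e \<and> b + c \<le> e + f"
    using that assms by (intro reaches_12) auto
  have B: "reaches ?p" if "e \<le> c" "f \<le> e" "e \<le> a + b" "e \<le> h \<or> f \<le> h \<and> e + f \<le> a + h"
    using that assms by (intro rot3[OF reaches_12]) auto
  have C: "reaches ?p" if "c \<le> e" "b \<le> c" "c \<le> a + b" "c \<le> h \<or> b + c \<le> g + h"
    using that assms by (intro rev4[OF reaches_12]) auto
  have D: "reaches ?p" if "h \<le> f" "h \<le> a + b" "h \<le> c \<or> a + h \<le> c + d"
    using that assms by (intro rot6[OF reaches_12]) auto
  have E: "reaches ?p" if "f \<le> h" "e \<le> f" "f \<le> a + b" "f \<le> c \<or> e \<le> c \<and> e + f \<le> b + c"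
    using that assms by (intro rev7[OF reaches_12]) auto
  have F: "reaches ?p" if "a + b \<le> c" "a + b \<le> e" "a + b \<le> h \<or> a + b + b \<le> g + h"
    using that assms by (intro rev4[OF reaches_23]) auto
  have G: "reaches ?p" if "a + b \<le> h" "a + b \<le> f" "a + b \<le> c \<or> a + a + b \<le> c + d"
    using that assms by (intro rot6[OF reaches_23]) auto
  have H: "reaches ?p" if "e \<le> b" "f \<le> e" "f \<le> c"
    using that assms by (intro rev1[OF reaches_34]) auto
  have I: "reaches ?p" if "h \<le> c" "h \<le> e" "h \<le> a + b" "a \<le> f"
    using that assms by (intro rev4[OF reaches_34]) auto
  have J: "reaches ?p" if "c \<le> h" "c \<le> f" "b \<le> c" "c \<le> a + b" "b \<le> e"
    using that assms by (intro rot6[OF reaches_34]) auto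
  have K: "reaches ?p" if "c \<le> f" "c \<le> e" "e + f \<le> b + c"
    using that assms by (intro rev1[OF reaches_34']) auto
  have L: "reaches ?p" if "f \<le> a" "h \<le> b + f" "a + h \<le> c + f" "a + h \<le> e + f"
    using that assms by (intro rev4[OF reaches_34']) auto
  have M: "reaches ?p" if "e \<le> b" "e \<le> c" "c \<le> a + e" "b + c \<le> e + h" "b + c \<le> e + f"
    using that assms by (intro rot6[OF reaches_34']) auto
  consider "e \<le> c" "f \<le> e" "c \<le> b" | "e \<le> c" "f \<le> e" "b < c"
    | "e \<le> c" "e < f" "e \<le> b" | "e \<le> c" "e < f" "b < e"
    | "c < e" "c \<le> b" | "c < e" "b < c" "f \<le> e" | "c < e" "b < c" "e < f"
    by (meson not_le)
  then show ?thesis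
  proof cases
    case 1
    then show ?thesis using H by linarith
  next
    case 2
    \<comment> \<open>The least of \<open>e\<close>, \<open>a + b\<close> and \<open>h\<close>
      decides; if it is \<open>h\<close>, stack \<open>f\<close> is also compared with
      \<open>a\<close>.\<close>
    consider "e \<le> a + b" "e \<le> h" | "a + b \<le> e" "a + b \<le> h" | "h \<le> a + b" "h \<le> e" "a \<le> f"
      | "h < a + b" "h < e" "f < a"
      by linarith
    then show ?thesis
    proof cases
      case 4
      show ?thesis
      proof (cases "a + b \<le> e")
        case True
        \<comment> \<open>If \<open>b + f \<le> h\<close>, adding \<open>a + b \<le> f + g\<close>
          gives the second alternative of F; otherwise \<open>h < b + f\<close> opens L.\<close>
        then show ?thesis using F L 2 4 assms by (cases "b + f \<le> h") auto
      next
        case False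
        then show ?thesis using B L 2 4 assms by (cases "e + f \<le> a + h") auto
      qed
    qed (use B F I 2 in auto)
  next
    case 3
    \<comment> \<open>The least of \<open>f\<close>, \<open>h\<close> and \<open>a + b\<close>
      suggests E, D or G. If its side condition fails, \<open>c\<close> is small enough for M; for D
      and G this uses \<open>a + b \<le> d + e\<close>.\<close>
    consider "f \<le> a + b" "f \<le> h" | "h \<le> a + b" "h \<le> f" | "a + b \<le> h" "a + b \<le> f"
      by linarith
    then show ?thesis
    proof cases
      case 1
      then show ?thesis using E M 3 assms by (cases "e + f \<le> b + c") auto
    next
      case 2
      then show ?thesis using D M 3 assms by (cases "a + h \<le> c + d") auto
    next
      case 3
      then show ?thesis using G M \<open>e \<le> c\<close> \<open>e \<le> b\<close> assms by (cases "a + a + b \<le> c + d") auto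
    qed
  next
    case 4
    consider "h \<le> f" "h \<le> a + b" "h \<le> c" | "f \<le> h" "f \<le> a + b" "f \<le> c"
      | "a + b \<le> h" "a + b \<le> f" "a + b \<le> c" | "c \<le> h" "c \<le> f" "c \<le> a + b"
      by linarith
    then show ?thesis by cases (use D E G J 4 in auto)
  next
    case 5
    show ?thesis
    proof (cases "b + c \<le> e + f")
      case True
      then show ?thesis using A 5 by simp
    next
      case False
      \<comment> \<open>K serves if \<open>c \<le> f\<close>. For \<open>f < c\<close>, A serves if
        \<open>b \<le> e\<close>, and H otherwise.\<close>
      then show ?thesis using A H K 5 by (cases "c \<le> f"; cases "b \<le> e") auto
    qed
  next
    case 6
    \<comment> \<open>As in the case \<open>f \<le> e\<close>, \<open>e \<le> c\<close>,
      \<open>b < c\<close>, with \<open>c\<close> in place of \<open>e\<close> and C in place of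
      B.\<close>
    consider "c \<le> a + b" "c \<le> h" | "a + b \<le> c" "a + b \<le> h" | "h \<le> a + b" "h \<le> c" "a \<le> f"
      | "h < a + b" "h < c" "f < a"
      by linarith
    then show ?thesis
    proof cases
      case 4
      show ?thesis
      proof (cases "a + b \<le> c")
        case True
        then show ?thesis using F L 6 4 assms by (cases "b + f \<le> h") auto
      next
        case False
        then show ?thesis using C L 6 4 assms by (cases "b + c \<le> g + h") auto
      qed
    qed (use C F I 6 in auto)
  next
    case 7
    consider "c \<le> a + b" "c \<le> h" | "a + b \<le> c" "a + b \<le> h" | "h \<le> a + b" "h \<le> c"
      by linarith
    then show ?thesis by cases (use G I J 7 assms in auto)
  qed
qed

lemma reaches_all:
  assumes "length p = 8"
  shows "reaches p"
proof -
  define s where "s i = p ! i + p ! ((i + 1) mod 8)" for i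
  obtain i where i: "i < 8" "\<forall>j<8. s i \<le> s j"
    using ex_has_least_nat[of "\<lambda>i. i < 8" 0 s] by auto
  have "length (rotate i p) = 8" using assms by simp
  then obtain a b c d e f g h where r: "rotate i p = [a, b, c, d, e, f, g, h]"
    by (rule length_8E)
  have nth: "rotate i p ! j = p ! ((i + j) mod 8)" if "j < 8" for j
    using assms that by (simp add: nth_rotate)
  have "rotate i p ! 0 + rotate i p ! 1 \<le> rotate i p ! j + rotate i p ! ((j + 1) mod 8)" if "j < 8" for j
  proof -
    have "s i \<le> s ((i + j) mod 8)" using i(2) by simp
    then show ?thesis using i(1) that by (simp add: nth s_def mod_simps add.assoc)
  qed
  from this[of 1] this[of 2] this[of 3] this[of 4] this[of 5] this[of 6] this[of 7]
  have min: "a \<le> c" "b \<le> h" "a + b \<le> c + d" "a + b \<le> d + e" "a + b \<le> e + f" "a + b \<le> f + g"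
    "a + b \<le> g + h"
    unfolding r by simp_all
  have "reaches (rotate i p)"
  proof (cases "a \<le> b")
    case True
    then show ?thesis unfolding r using min by (intro reaches_if_min_pair)
  next
    case False
    \<comment> \<open>The reflection exchanging stacks 0 and 1 keeps the least pair in place and
      puts its lower stack first.\<close>
    then have "reaches [b, a, h, g, f, e, d, c]"
      using min by (intro reaches_if_min_pair) auto
    then show ?thesis
      unfolding r using reaches_rev_rotate[of "[a, b, c, d, e, f, g, h]" 2]
      by (simp add: rotate_drop_take)
  qed
  then show ?thesis using assms reaches_rotate[of p i] by force
qed

section \<open>From the two move properties to the outcome of play\<close>

lemma sym_family_no_move:
  assumes "p \<in> sym_family" "cn_move 8 6 p q"
  shows "q \<notin> sym_family"
proof
  assume q: "q \<in> sym_family"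
  have keeps: "keeps p q" "q \<noteq> p" using assms(2) by (simp_all add: cn_move_8_6)
  then have ne: "q \<noteq> []" and len: "length q = length p" unfolding keeps_def by auto
  have inj: "q = p" if "rotate m q = rotate m p" for m
    by (metis rotate_inverse that len)
  \<comment> \<open>The symmetry taking \<open>p\<close> into \<open>family\<close> is applied to
    both positions; \<open>family_no_move\<close> identifies the images, and symmetries are
    injective.\<close>
  obtain p' where p': "p' \<in> symmetries p" "p' \<in> family"
    using assms(1) unfolding sym_family_def by blast
  from p'(1) show False
  proof (cases rule: symmetries_cases)
    case (1 m)
    have "rotate m q = rotate m p"
      using family_no_move[OF p'(2) sym_family_symmetries[OF q rotate_in_symmetries[OF ne]]]
        keeps_rotate[OF keeps(1)] 1 by blast
    then show False using inj keeps(2) by auto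
  next
    case (2 m)
    have "rev (rotate m q) = rev (rotate m p)"
      using family_no_move[OF p'(2) sym_family_symmetries[OF q rev_rotate_in_symmetries[OF ne]]]
        keeps_rev[OF keeps_rotate[OF keeps(1)]] 2 by blast
    then show False using inj keeps(2) by auto
  qed
qed

text \<open>Both sets obey the same rule on options. As moves lower the number of tokens, induction
  on that number shows that the rule determines the set.\<close>

lemma losing_positions_eqI:
  assumes "T \<subseteq> positions n"
    and no_move: "\<And>p q. p \<in> T \<Longrightarrow> cn_move n k p q \<Longrightarrow> q \<notin> T"
    and move: "\<And>p. p \<in> positions n \<Longrightarrow> p \<notin> T \<Longrightarrow> \<exists>q\<in>T. cn_move n k p q"
  shows "losing_positions n k = T"
proof -
  have "p \<in> losing_positions n k \<longleftrightarrow> p \<in> T" for p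
  proof (induction "sum_list p" arbitrary: p rule: less_induct)
    case less
    have IH: "q \<in> losing_positions n k \<longleftrightarrow> q \<in> T" if "cn_move n k p q" for q
      using less cn_move_sum_list_less[OF that] by blast
    show ?case
      using IH assms(1) no_move move losing_positions_iff[of p n k] by blast
  qed
  then show ?thesis by blast
qed

theorem theorem4p1:
  "losing_positions 8 6 =
     {p. \<exists>q \<in> symmetries p.
        q \<in> {[0, x, a1, b1, e, b2, a2, x] | x a1 b1 e b2 a2.
               a1 + b1 = x \<and> a2 + b2 = x \<and> e = min x (a1 + a2)}}"
proof -
  have "losing_positions 8 6 = sym_family"
  proof (rule losing_positions_eqI)
    show "sym_family \<subseteq> positions 8"
      using length_sym_family unfolding positions_def by blast
    \<comment> \<open>As \<open>p\<close> lies outside the family, the member it reaches differs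
      from it, so the move is a genuine one.\<close>
    show "\<exists>q\<in>sym_family. cn_move 8 6 p q" if "p \<in> positions 8" "p \<notin> sym_family" for p
      using that reaches_all[of p] unfolding reaches_def positions_def cn_move_8_6 by blast
  qed (rule sym_family_no_move)
  then show ?thesis unfolding sym_family_def family_def .
qed

end
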